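(* Let $A \in \mathbb{R}^{n\times n}$ be a symmetric positive definite matrix with unit diagonal ($a_{11}=\dots=a_{nn}=1$), let $\sigma = \lambda_{\min}(A) \in (0,1]$, and let $f(x) = \frac12 x^\top A x$. For an initial point $x_0 \in \mathbb{R}^n$, let $x_T$ be the output of random coordinate descent (RCD) applied to $f$ after $T$ iterations. Then, for all $x_0$ outside a Lebesgue measure zero set of initial points, $$\lim_{T\to\infty} \left(\frac{\mathbb{E}\left[\|x_T\|^2\right]}{\|x_0\|^2}\right)^{1/T} \ge \max\left\{ 1-\frac1n,\ \left(1-\frac{\sigma}{n}\right)^2 \right\}.$$
   Context: Random coordinate descent (RCD) on $f(x)=\frac12 x^\top A x$, started at a deterministic $x_0\in\mathbb{R}^n$: at each iteration $t=0,1,2,\dots$, an index $i_t$ is drawn uniformly at random from $\{1,\dots,n\}$, independently across iterations, and the coordinate $i_t$ of $x_t$ is replaced by the exact minimizer of $f$ over that coordinate, all other coordinates being kept fixed. Since $A$ has unit diagonal, this is $x_{t+1} = (I - E_{i_t}A)x_t$, where $E_i = e_i e_i^\top$ and $e_i$ is the $i$-th standard basis vector. $\|\cdot\|$ is the Euclidean norm, $\lambda_{\min}$ the smallest eigenvalue, and the expectation is over the random indices, conditional on $x_0$. *)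

theory Defs
  imports "HOL-Probability.Probability"
begin

definition positive_definite :: "real^'n^'n \<Rightarrow> bool" where
  "positive_definite A \<longleftrightarrow> (\<forall>x. x \<noteq> 0 \<longrightarrow> 0 < x \<bullet> (A *v x))"

definition eigenvalues :: "real^'n^'n \<Rightarrow> real set" where
  "eigenvalues A = {l. \<exists>v. v \<noteq> 0 \<and> A *v v = l *\<^sub>R v}"

text \<open>The set of real eigenvalues is always finite, and it is nonempty for symmetric \<open>A\<close>,
  so that \<open>Min\<close> is meaningful there.\<close>

definition lambda_min :: "real^'n^'n \<Rightarrow> real" where
  "lambda_min A = Min (eigenvalues A)"

definition quadratic :: "real^'n^'n \<Rightarrow> real^'n \<Rightarrow> real" where
  "quadratic A x = 1/2 * (x \<bullet> (A *v x))"

definition set_coord :: "real^'n \<Rightarrow> 'n \<Rightarrow> real \<Rightarrow> real^'n" where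
  "set_coord x i s = (\<chi> j. if j = i then s else x $ j)"

definition coord_min_step :: "(real^'n \<Rightarrow> real) \<Rightarrow> 'n \<Rightarrow> real^'n \<Rightarrow> real^'n" where
  "coord_min_step f i x = set_coord x i (ARG_MIN (\<lambda>s. f (set_coord x i s)) s. True)"

text \<open>\<open>rcd f x0 T\<close> is the distribution of the \<open>T\<close>-th iterate. Drawing the index
  inside the recursion, with a law that does not depend on \<open>x\<close>, makes the indices independent
  across iterations.\<close>

primrec rcd :: "(real^'n \<Rightarrow> real) \<Rightarrow> real^'n \<Rightarrow> nat \<Rightarrow> (real^'n) pmf" where
  "rcd f x0 0 = return_pmf x0"
| "rcd f x0 (Suc t) =
     bind_pmf (rcd f x0 t) (\<lambda>x. map_pmf (\<lambda>i. coord_min_step f i x) (pmf_of_set UNIV))"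

text \<open>For unit diagonal, exact coordinate minimization of the quadratic is
  \<open>x \<mapsto> (I - E\<^sub>i A) x\<close> with \<open>E\<^sub>i = e\<^sub>i e\<^sub>i\<^sup>T\<close>.\<close>

lemma set_coord_eq: "set_coord x i s = x + (s - x $ i) *\<^sub>R axis i 1"
  by (simp add: set_coord_def vec_eq_iff axis_def)

lemma coord_min_step_quadratic:
  fixes A :: "real^'n^'n"
  assumes sym: "transpose A = A" and diag: "\<And>i. A $ i $ i = 1"
  shows "coord_min_step (quadratic A) i x
    = (mat 1 - (\<chi> j k. axis i 1 $ j * axis i 1 $ k) ** A) *v x"
proof -
  let ?e = "axis i 1 :: real^'n"
  define s0 where "s0 = x $ i - (A *v x) $ i"
  have symd: "u \<bullet> (A *v v) = (A *v u) \<bullet> v" for u v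
    by (metis dot_lmul_matrix sym transpose_matrix_vector)
  have eAe: "?e \<bullet> (A *v ?e) = 1"
    by (simp add: inner_axis' matrix_vector_mul_component inner_axis diag)
  have eAx: "?e \<bullet> (A *v x) = (A *v x) $ i"
    by (simp add: inner_axis')
  have xAe: "x \<bullet> (A *v ?e) = (A *v x) $ i"
    unfolding symd by (simp add: inner_axis)
  have val: "quadratic A (set_coord x i s)
      = 1/2 * (x \<bullet> (A *v x)) - 1/2 * ((A *v x) $ i)\<^sup>2 + 1/2 * (s - s0)\<^sup>2" for s
  proof -
    have "quadratic A (set_coord x i s)
      = 1/2 * (x \<bullet> (A *v x) + 2 * (s - x $ i) * (A *v x) $ i + (s - x $ i)\<^sup>2)"
      unfolding quadratic_def set_coord_eq
      by (simp only: matrix_vector_right_distrib matrix_vector_mult_scaleR inner_add_left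
            inner_add_right inner_scaleR_left inner_scaleR_right eAe eAx xAe)
         (simp add: algebra_simps power2_eq_square)
    then show ?thesis
      by (simp add: s0_def algebra_simps power2_eq_square)
  qed
  have "(ARG_MIN (\<lambda>s. quadratic A (set_coord x i s)) s. True) = s0"
  proof -
    have "is_arg_min (\<lambda>s. quadratic A (set_coord x i s)) (\<lambda>s. True) s \<longleftrightarrow> s = s0" for s
    proof
      assume "is_arg_min (\<lambda>s. quadratic A (set_coord x i s)) (\<lambda>s. True) s"
      then have "\<not> quadratic A (set_coord x i s0) < quadratic A (set_coord x i s)"
        by (simp add: is_arg_min_def)
      then show "s = s0"
        by (simp add: val)
    next
      assume "s = s0"
      then show "is_arg_min (\<lambda>s. quadratic A (set_coord x i s)) (\<lambda>s. True) s"
        by (simp add: is_arg_min_def val not_less)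
    qed
    then show ?thesis
      by (simp add: arg_min_def)
  qed
  then have "coord_min_step (quadratic A) i x = x - (A *v x) $ i *\<^sub>R ?e"
    by (simp add: coord_min_step_def set_coord_eq s0_def)
  moreover have "(\<chi> j k. ?e $ j * ?e $ k) *v y = y $ i *\<^sub>R ?e" for y
  proof -
    have "(\<Sum>k\<in>UNIV. ?e $ j * ?e $ k * y $ k) = ?e $ j * y $ i" for j
    proof -
      have "(\<Sum>k\<in>UNIV. ?e $ j * ?e $ k * y $ k) = ?e $ j * (?e \<bullet> y)"
        by (simp add: inner_vec_def sum_distrib_left mult.assoc)
      then show ?thesis
        by (simp only: inner_axis' inner_real_def mult_1_left)
    qed
    then show ?thesis
      by (simp add: vec_eq_iff matrix_vector_mult_def mult.commute)
  qed
  ultimately show ?thesis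
    by (simp add: matrix_vector_mult_diff_rdistrib flip: matrix_vector_mul_assoc)
qed

end

theory Submission
  imports Defs
begin

text \<open>
  Put \<open>C = A\<^sup>1\<^sup>/\<^sup>2\<close>. In the coordinates \<open>y = C x\<close> every step is an orthogonal projection
  \<open>B\<^sub>i = I - u\<^sub>i u\<^sub>i\<^sup>T\<close> with \<open>u\<^sub>i = C e\<^sub>i\<close> a unit vector, so that \<open>E[y\<^sub>T\<^sup>T X y\<^sub>T] = y\<^sub>0\<^sup>T K\<^sup>T(X) y\<^sub>0\<close>
  for the operator \<open>K X = 1/n \<Sum>\<^sub>i B\<^sub>i X B\<^sub>i\<close>. On symmetric matrices with the Frobenius inner product
  \<open>K\<close> is self-adjoint and positive semidefinite; let \<open>r\<close> be its largest eigenvalue and \<open>M\<close> a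
  corresponding eigenmatrix. Then \<open>E[\<bar>y\<^sub>T\<bar>\<^sup>2] = y\<^sub>0\<^sup>T K\<^sup>T(I) y\<^sub>0\<close> is at most a constant times \<open>r\<^sup>T\<close>, while
  \<open>\<bar>y\<^sup>T M y\<bar> \<le> c \<bar>y\<bar>\<^sup>2\<close> bounds it below by a constant times \<open>r\<^sup>T \<bar>y\<^sub>0\<^sup>T M y\<^sub>0\<bar>\<close>, which is positive off a
  null set. Hence the limit is \<open>r\<close>, and the two lower bounds are the Rayleigh quotients of \<open>K\<close> at
  \<open>I\<close> and at \<open>v v\<^sup>T\<close>, where \<open>v\<close> is a unit eigenvector of \<open>A\<close> for \<open>\<sigma>\<close>.
\<close>

subsection \<open>Self-adjoint maps on Euclidean spaces\<close>

text \<open>The form of \<open>f\<close> is nonnegative along the line through \<open>x\<close> in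
  direction \<open>y\<close>; a quadratic polynomial in \<open>t\<close> without negative values has
  nonpositive discriminant.\<close>

lemma self_adjoint_Cauchy_Schwarz:
  fixes f :: "'a::real_inner \<Rightarrow> 'a"
  assumes lin: "linear f" and S: "subspace S"
    and sa: "\<And>x y. x \<in> S \<Longrightarrow> y \<in> S \<Longrightarrow> f x \<bullet> y = x \<bullet> f y"
    and psd: "\<And>x. x \<in> S \<Longrightarrow> 0 \<le> x \<bullet> f x"
    and x: "x \<in> S" and y: "y \<in> S"
  shows "(f x \<bullet> y)\<^sup>2 \<le> (x \<bullet> f x) * (y \<bullet> f y)"
proof -
  define a b c where "a = x \<bullet> f x" and "b = f x \<bullet> y" and "c = y \<bullet> f y"
  have b': "x \<bullet> f y = b" "y \<bullet> f x = b"
    using sa[OF x y] by (auto simp: b_def inner_commute)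
  have q: "0 \<le> a - 2 * t * b + t\<^sup>2 * c" for t
  proof -
    have "x - t *\<^sub>R y \<in> S" using S x y by (simp add: subspace_diff subspace_scale)
    from psd[OF this] show ?thesis
      by (simp add: linear_diff[OF lin] linear_scale[OF lin] inner_diff_left inner_diff_right b'
          flip: a_def c_def) (simp add: algebra_simps power2_eq_square)
  qed
  have a0: "a \<ge> 0" and c0: "c \<ge> 0" using psd x y by (auto simp: a_def c_def)
  have "b\<^sup>2 \<le> a * c"
  proof (cases "c = 0")
    case True
    have "b = 0"
    proof (rule ccontr)
      assume "b \<noteq> 0"
      \<comment> \<open>With \<open>c = 0\<close> the polynomial is affine in \<open>t\<close>, and
        this \<open>t\<close> gives it the value -1.\<close>
      then show False using q[of "(a + 1) / (2 * b)"] True by (simp add: field_simps)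
    qed
    then show ?thesis using True by simp
  next
    case False
    then have "c > 0" using c0 by simp
    then show ?thesis using q[of "b / c"] by (simp add: field_simps power2_eq_square)
  qed
  then show ?thesis by (simp add: a_def b_def c_def)
qed

text \<open>\<open>v\<close> maximizes the Rayleigh quotient on the compact unit sphere of
  \<open>S\<close>. Then \<open>r I - f\<close> is positive semidefinite on \<open>S\<close> with
  vanishing form at \<open>v\<close>, and Cauchy-Schwarz for that form forces it to annihilate
  \<open>v\<close>.\<close>

lemma self_adjoint_max_eigenvector:
  fixes f :: "'a::euclidean_space \<Rightarrow> 'a"
  assumes lin: "linear f" and S: "subspace S" and inv: "\<And>x. x \<in> S \<Longrightarrow> f x \<in> S"
    and sa: "\<And>x y. x \<in> S \<Longrightarrow> y \<in> S \<Longrightarrow> f x \<bullet> y = x \<bullet> f y"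
    and ne: "w \<in> S" "w \<noteq> 0"
  obtains v r where "v \<in> S" "norm v = 1" "f v = r *\<^sub>R v" "\<And>x. x \<in> S \<Longrightarrow> x \<bullet> f x \<le> r * (x \<bullet> x)"
proof -
  have "compact (sphere 0 1 \<inter> S)"
    using closed_subspace[OF S] by (intro compact_Int_closed compact_sphere)
  moreover have "(1 / norm w) *\<^sub>R w \<in> sphere 0 1 \<inter> S"
    using ne S by (simp add: subspace_scale)
  moreover have "continuous_on (sphere 0 1 \<inter> S) (\<lambda>x. x \<bullet> f x)"
    by (intro continuous_intros linear_continuous_on_compose[OF continuous_on_id lin])
  ultimately obtain v where v: "v \<in> sphere 0 1 \<inter> S"
    and max: "\<And>x. x \<in> sphere 0 1 \<inter> S \<Longrightarrow> x \<bullet> f x \<le> v \<bullet> f v"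
    using continuous_attains_sup[of "sphere 0 1 \<inter> S" "\<lambda>x. x \<bullet> f x"] by blast
  define r where "r = v \<bullet> f v"
  have vS: "v \<in> S" and nv: "norm v = 1" using v by auto
  have le: "x \<bullet> f x \<le> r * (x \<bullet> x)" if "x \<in> S" for x
  proof (cases "x = 0")
    case True
    then show ?thesis by simp
  next
    case False
    have "(1 / norm x) *\<^sub>R x \<in> sphere 0 1 \<inter> S"
      using False that S by (simp add: subspace_scale)
    from max[OF this] have "(x \<bullet> f x) / (norm x)\<^sup>2 \<le> r"
      by (simp add: linear_scale[OF lin] r_def power2_eq_square)
    then show ?thesis using False by (simp add: field_simps power2_norm_eq_inner)
  qed
  define g where "g x = r *\<^sub>R x - f x" for x
  have "linear g"
    by (rule linearI) (simp_all add: g_def linear_add[OF lin] linear_scale[OF lin] algebra_simps)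
  moreover have gS: "g x \<in> S" if "x \<in> S" for x
    using that S inv by (simp add: g_def subspace_diff subspace_scale)
  moreover have "g x \<bullet> y = x \<bullet> g y" if "x \<in> S" "y \<in> S" for x y
    using sa[OF that] by (simp add: g_def inner_diff_left inner_diff_right)
  moreover have "0 \<le> x \<bullet> g x" if "x \<in> S" for x
    using le[OF that] by (simp add: g_def inner_diff_right)
  ultimately have "(g v \<bullet> g v)\<^sup>2 \<le> (v \<bullet> g v) * (g v \<bullet> g (g v))"
    by (intro self_adjoint_Cauchy_Schwarz[OF _ S] vS gS)
  moreover have "v \<bullet> g v = 0"
    using nv by (simp add: g_def inner_diff_right r_def flip: power2_norm_eq_inner)
  ultimately have "f v = r *\<^sub>R v" by (simp add: g_def)
  then show thesis using that vS nv le by blast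
qed

text \<open>Cauchy-Schwarz for the form of \<open>f\<close> at \<open>x\<close> and
  \<open>f x\<close>, divided by the squared norm of \<open>f x\<close>, turns the bound on Rayleigh
  quotients into a norm bound.\<close>

lemma self_adjoint_psd_norm_le:
  fixes f :: "'a::real_inner \<Rightarrow> 'a"
  assumes lin: "linear f" and S: "subspace S" and inv: "\<And>x. x \<in> S \<Longrightarrow> f x \<in> S"
    and sa: "\<And>x y. x \<in> S \<Longrightarrow> y \<in> S \<Longrightarrow> f x \<bullet> y = x \<bullet> f y"
    and psd: "\<And>x. x \<in> S \<Longrightarrow> 0 \<le> x \<bullet> f x"
    and le: "\<And>x. x \<in> S \<Longrightarrow> x \<bullet> f x \<le> r * (x \<bullet> x)" and r: "0 \<le> r"
    and x: "x \<in> S"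
  shows "norm (f x) \<le> r * norm x"
proof (cases "f x = 0")
  case True
  then show ?thesis using r by simp
next
  case False
  have "(f x \<bullet> f x) * (f x \<bullet> f x) \<le> (x \<bullet> f x) * (f x \<bullet> f (f x))"
    using self_adjoint_Cauchy_Schwarz[OF lin S sa psd x inv[OF x]] by (simp add: power2_eq_square)
  also have "\<dots> \<le> (r * (x \<bullet> x)) * (r * (f x \<bullet> f x))"
    using le psd x inv r by (intro mult_mono) auto
  finally have "f x \<bullet> f x \<le> r * (x \<bullet> x) * r"
    using False by simp
  then have "(norm (f x))\<^sup>2 \<le> (r * norm x)\<^sup>2"
    by (simp add: power_mult_distrib power2_norm_eq_inner) (simp add: power2_eq_square algebra_simps)
  then show ?thesis using r by (simp add: power2_le_iff_abs_le)
qed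

text \<open>An orthonormal set of eigenvectors of greatest cardinality spans: its orthogonal
  complement is invariant under \<open>f\<close> and, if nonzero, would contain a further unit
  eigenvector.\<close>

lemma self_adjoint_orthonormal_eigenbasis:
  fixes f :: "'a::euclidean_space \<Rightarrow> 'a"
  assumes lin: "linear f" and sa: "\<And>x y. f x \<bullet> y = x \<bullet> f y"
  obtains B where "finite B" "pairwise orthogonal B" "\<And>b. b \<in> B \<Longrightarrow> norm b = 1"
    "\<And>b. b \<in> B \<Longrightarrow> \<exists>l. f b = l *\<^sub>R b" "span B = UNIV"
proof -
  define P where "P B \<longleftrightarrow> pairwise orthogonal B \<and> (\<forall>b\<in>B. norm b = 1 \<and> (\<exists>l. f b = l *\<^sub>R b))" for B
  have indep: "independent B" if "P B" for B
    using that by (intro pairwise_orthogonal_independent) (auto simp: P_def)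
  have "\<exists>B. P B \<and> (\<forall>B'. P B' \<longrightarrow> card B' \<le> card B)"
  proof (rule Lattices_Big.ex_has_greatest_nat)
    show "P {}" by (simp add: P_def)
    show "\<forall>B. P B \<longrightarrow> card B < Suc (DIM('a))"
      using indep independent_bound by (auto simp: less_Suc_eq_le)
  qed
  then obtain B where B: "P B" and max: "\<And>B'. P B' \<Longrightarrow> card B' \<le> card B" by blast
  have fin: "finite B" using indep[OF B] independent_bound by blast
  have "span B = UNIV"
  proof (rule ccontr)
    assume "span B \<noteq> UNIV"
    then obtain w where w: "w \<noteq> 0" "\<And>x. x \<in> span B \<Longrightarrow> orthogonal w x"
      using orthogonal_to_subspace_exists_gen[of B UNIV] span_UNIV by (metis top.not_eq_extremum)
    define S where "S = {x. \<forall>b\<in>B. b \<bullet> x = 0}"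
    have S: "subspace S"
      by (auto simp: subspace_def S_def inner_add_right)
    have wS: "w \<in> S"
      using w(2) span_base by (auto simp: S_def orthogonal_def inner_commute)
    have inv: "f x \<in> S" if "x \<in> S" for x
      unfolding S_def
    proof safe
      fix b assume b: "b \<in> B"
      then obtain l where "f b = l *\<^sub>R b" using B by (auto simp: P_def)
      then have "b \<bullet> f x = l * (b \<bullet> x)" by (simp flip: sa)
      then show "b \<bullet> f x = 0" using that b by (simp add: S_def)
    qed
    obtain v r where v: "v \<in> S" "norm v = 1" "f v = r *\<^sub>R v"
      using self_adjoint_max_eigenvector[OF lin S inv sa wS w(1)] by blast
    have "v \<notin> B" using v by (auto simp: S_def)
    moreover have "P (insert v B)"
      using B v by (auto simp: P_def pairwise_insert S_def orthogonal_def inner_commute)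
    ultimately show False using max[of "insert v B"] fin by simp
  qed
  then show thesis using that B fin by (auto simp: P_def)
qed

text \<open>The Gram-Schmidt residual is orthogonal to the whole space, in particular to
  itself.\<close>

lemma orthonormal_expansion:
  fixes x :: "'a::euclidean_space"
  assumes fin: "finite B" and orth: "pairwise orthogonal B" and nrm: "\<And>b. b \<in> B \<Longrightarrow> norm b = 1"
    and span: "span B = UNIV"
  shows "(\<Sum>b\<in>B. (b \<bullet> x) *\<^sub>R b) = x"
proof -
  have "orthogonal (x - (\<Sum>b\<in>B. (b \<bullet> x / (b \<bullet> b)) *\<^sub>R b)) x'" for x'
    using Gram_Schmidt_step[OF orth, of x'  x] span by (simp add: orthogonal_commute)
  then have "x - (\<Sum>b\<in>B. (b \<bullet> x / (b \<bullet> b)) *\<^sub>R b) = 0"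
    by (metis orthogonal_self)
  moreover have "b \<bullet> b = 1" if "b \<in> B" for b
    using nrm[OF that] by (simp add: dot_square_norm)
  ultimately show ?thesis by simp
qed

subsection \<open>Symmetric matrices\<close>

definition outer :: "real^'n \<Rightarrow> real^'n^'n" where
  "outer v = (\<chi> i j. v $ i * v $ j)"

lemma outer_mult_vec: "outer v *v x = (v \<bullet> x) *\<^sub>R v"
  by (simp add: vec_eq_iff outer_def matrix_vector_mult_def inner_vec_def
      sum_distrib_left sum_distrib_right mult_ac)

lemma transpose_outer [simp]: "transpose (outer v) = outer v"
  by (simp add: vec_eq_iff outer_def transpose_def mult.commute)

text \<open>On matrices \<open>\<bullet>\<close> is the Frobenius product; pairing with
  \<open>outer v\<close> makes a quadratic form linear in its matrix.\<close>

lemma inner_outer: "M \<bullet> outer v = v \<bullet> (M *v v)"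
  by (simp add: inner_vec_def outer_def matrix_vector_mult_def sum_distrib_left mult_ac)

lemma trace_outer: "trace (outer v) = v \<bullet> v"
  by (simp add: trace_def outer_def inner_vec_def)

lemma inner_matrix_trace: "(X::real^'n^'n) \<bullet> Y = trace (transpose X ** Y)"
  by (simp add: inner_vec_def trace_def matrix_matrix_mult_def transpose_def) (rule sum.swap)

lemma inner_matrix_sandwich:
  fixes X Y B :: "real^'n^'n"
  assumes "transpose B = B"
  shows "(B ** X ** B) \<bullet> Y = X \<bullet> (B ** Y ** B)"
proof -
  have "(B ** X ** B) \<bullet> Y = trace (B ** (transpose X ** B ** Y))"
    by (simp add: inner_matrix_trace matrix_transpose_mul assms matrix_mul_assoc)
  also have "\<dots> = X \<bullet> (B ** Y ** B)"
    by (subst trace_mul_sym) (simp add: inner_matrix_trace matrix_mul_assoc)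
  finally show ?thesis .
qed

lemma symmetric_matrix_inner:
  fixes A :: "real^'n^'n"
  assumes "transpose A = A"
  shows "(A *v x) \<bullet> y = x \<bullet> (A *v y)"
  by (metis assms dot_lmul_matrix transpose_matrix_vector)

text \<open>Polarization: if the quadratic form of a symmetric matrix vanishes everywhere, so does
  its bilinear form.\<close>

lemma symmetric_quadratic_form_nonzero:
  fixes M :: "real^'n^'n"
  assumes "transpose M = M" "M \<noteq> 0"
  obtains v where "v \<bullet> (M *v v) \<noteq> 0"
proof (rule ccontr)
  assume "\<not> thesis"
  then have z: "v \<bullet> (M *v v) = 0" for v using that by blast
  have "x \<bullet> (M *v y) = 0" for x y
    using z[of "x + y"] z[of x] z[of y] symmetric_matrix_inner[OF assms(1), of x y]
    by (simp add: matrix_vector_right_distrib inner_add_left inner_add_right inner_commute)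
  then have "M *v y = 0 *v y" for y
    by (metis inner_eq_zero_iff matrix_vector_mult_0)
  then show False using assms(2) matrix_eq by blast
qed

text \<open>Eigenvectors for distinct eigenvalues are orthogonal, hence independent, so the
  dimension bounds their number.\<close>

lemma finite_eigenvalues:
  fixes A :: "real^'n^'n"
  assumes "transpose A = A"
  shows "finite (eigenvalues A)"
proof -
  have "\<forall>l\<in>eigenvalues A. \<exists>v. v \<noteq> 0 \<and> A *v v = l *\<^sub>R v" by (simp add: eigenvalues_def)
  then obtain v where v: "\<And>l. l \<in> eigenvalues A \<Longrightarrow> v l \<noteq> 0 \<and> A *v v l = l *\<^sub>R v l"
    by metis
  have orth: "v l \<bullet> v m = 0" if "l \<in> eigenvalues A" "m \<in> eigenvalues A" "l \<noteq> m" for l m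
    using symmetric_matrix_inner[OF assms, of "v l" "v m"] v[OF that(1)] v[OF that(2)] that(3) by simp
  have "inj_on v (eigenvalues A)"
  proof (rule inj_onI, rule ccontr)
    fix l m assume "l \<in> eigenvalues A" "m \<in> eigenvalues A" "v l = v m" "l \<noteq> m"
    then show False using orth[of l m] v[of l] by simp
  qed
  moreover have "independent (v ` eigenvalues A)"
  proof (rule pairwise_orthogonal_independent)
    show "pairwise orthogonal (v ` eigenvalues A)"
      using orth unfolding pairwise_image by (auto simp: pairwise_def orthogonal_def)
    show "0 \<notin> v ` eigenvalues A" using v by force
  qed
  then have "finite (v ` eigenvalues A)" using independent_bound by blast
  ultimately show ?thesis using finite_imageD by blast
qed

lemma lambda_min_eigenvector:
  fixes A :: "real^'n^'n"
  assumes "transpose A = A"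
  obtains v where "norm v = 1" "A *v v = lambda_min A *\<^sub>R v"
proof -
  have ax: "axis undefined 1 \<noteq> (0 :: real^'n)" by simp
  \<comment> \<open>Any eigenvalue will do here: it shows that \<open>Min\<close> is taken over a
    nonempty set.\<close>
  obtain v r where vr: "norm v = 1" "A *v v = r *\<^sub>R v"
    by (rule self_adjoint_max_eigenvector[OF matrix_vector_mul_linear subspace_UNIV UNIV_I
          symmetric_matrix_inner[OF assms] UNIV_I ax])
  moreover have "v \<noteq> 0" using vr(1) by auto
  ultimately have "r \<in> eigenvalues A" by (auto simp: eigenvalues_def)
  then have "lambda_min A \<in> eigenvalues A"
    unfolding lambda_min_def using finite_eigenvalues[OF assms] by (intro Min_in) auto
  then obtain w where w: "w \<noteq> 0" "A *v w = lambda_min A *\<^sub>R w" by (auto simp: eigenvalues_def)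
  show thesis
    by (rule that[of "(1 / norm w) *\<^sub>R w"]) (use w in \<open>auto simp: matrix_vector_mult_scaleR\<close>)
qed

lemma positive_definite_sqrt:
  fixes A :: "real^'n^'n"
  assumes sym: "transpose A = A" and pd: "positive_definite A"
  obtains C where "transpose C = C" "C ** C = A" "invertible C"
proof -
  obtain B where fin: "finite B" and orth: "pairwise orthogonal B"
    and nrm: "\<And>b. b \<in> B \<Longrightarrow> norm b = 1" and eig: "\<And>b. b \<in> B \<Longrightarrow> \<exists>l. A *v b = l *\<^sub>R b"
    and span: "span B = UNIV"
    using self_adjoint_orthonormal_eigenbasis[of "(*v) A"] symmetric_matrix_inner[OF sym] by auto
  define l where "l b = b \<bullet> (A *v b)" for b
  have Ab: "A *v b = l b *\<^sub>R b" if "b \<in> B" for b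
    using eig[OF that] nrm[OF that] by (auto simp: l_def dot_square_norm)
  have l0: "l b > 0" if "b \<in> B" for b
    using pd nrm[OF that] unfolding l_def positive_definite_def by (metis norm_zero zero_neq_one)
  \<comment> \<open>Spectral square root: the eigenvectors stay, and the eigenvalues, positive by
    definiteness, are replaced by their roots.\<close>
  define C where "C = (\<Sum>b\<in>B. sqrt (l b) *\<^sub>R outer b)"
  have Cx: "C *v x = (\<Sum>b\<in>B. (sqrt (l b) * (b \<bullet> x)) *\<^sub>R b)" for x
    unfolding C_def using fin
    by (induction B rule: finite_induct)
      (simp_all add: matrix_vector_mult_add_rdistrib outer_mult_vec scaleR_matrix_vector_assoc[symmetric])
  have symC: "transpose C = C"
    by (simp add: C_def vec_eq_iff transpose_def outer_def mult.commute)
  have Cb: "C *v b = sqrt (l b) *\<^sub>R b" if "b \<in> B" for b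
  proof -
    have "C *v b = (\<Sum>c\<in>B. if c = b then sqrt (l b) *\<^sub>R b else 0)"
      unfolding Cx using orth nrm that
      by (intro sum.cong) (auto simp: pairwise_def orthogonal_def dot_square_norm)
    then show ?thesis using fin that by simp
  qed
  have "C *v (C *v x) = A *v x" for x
  proof -
    have "C *v (C *v b) = A *v b" if "b \<in> B" for b
      using l0[OF that] Cb[OF that] Ab[OF that] by (simp add: matrix_vector_mult_scaleR)
    then have "(\<Sum>b\<in>B. (b \<bullet> x) *\<^sub>R (C *v (C *v b))) = (\<Sum>b\<in>B. (b \<bullet> x) *\<^sub>R (A *v b))"
      by simp
    moreover have "x = (\<Sum>b\<in>B. (b \<bullet> x) *\<^sub>R b)"
      by (rule orthonormal_expansion[OF fin orth nrm span, symmetric])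
    ultimately show ?thesis
      by (metis (no_types, lifting) linear_sum matrix_vector_mul_linear matrix_vector_mult_scaleR sum.cong)
  qed
  then have CC: "C ** C = A" by (simp add: matrix_eq flip: matrix_vector_mul_assoc)
  have "x = 0" if "C *v x = 0" for x
  proof (rule ccontr)
    assume "x \<noteq> 0"
    moreover have "A *v x = 0" using that CC by (metis matrix_vector_mul_assoc matrix_vector_mult_0_right)
    ultimately show False using pd by (force simp: positive_definite_def)
  qed
  then have "invertible C"
    by (simp add: invertible_left_inverse matrix_left_invertible_ker)
  then show thesis using that symC CC by blast
qed

subsection \<open>Quadratic forms vanish on null sets only\<close>

text \<open>Along a line in a direction on which the form does not vanish, the form is a polynomial
  of degree two; Fubini's theorem does the rest.\<close>

lemma AE_quadratic_form_nonzero: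
  fixes M :: "real^'n^'n"
  assumes v: "v \<bullet> (M *v v) \<noteq> 0"
  shows "AE x in lebesgue. x \<bullet> (M *v x) \<noteq> 0"
proof -
  have "AE t in lborel. (x + t *\<^sub>R v) \<bullet> (M *v (x + t *\<^sub>R v)) \<noteq> 0" for x :: "real^'n"
  proof -
    define p where "p = [: x \<bullet> (M *v x), x \<bullet> (M *v v) + v \<bullet> (M *v x), v \<bullet> (M *v v) :]"
    have "(x + t *\<^sub>R v) \<bullet> (M *v (x + t *\<^sub>R v)) = poly p t" for t
      by (simp add: p_def matrix_vector_right_distrib matrix_vector_mult_scaleR
          inner_add_left inner_add_right algebra_simps)
    \<comment> \<open>The leading coefficient is \<open>v \<bullet> (M *v v)\<close>, so
      \<open>p\<close> is not the zero polynomial.\<close>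
    moreover have "finite {t. poly p t = 0}" using v by (intro poly_roots_finite) (simp add: p_def)
    then have "{t. poly p t = 0} \<in> null_sets lborel" by (rule finite_imp_null_set_lborel)
    ultimately show ?thesis by (auto intro!: AE_I')
  qed
  then have "AE x in lborel. AE t in lborel. (x + t *\<^sub>R v) \<bullet> (M *v (x + t *\<^sub>R v)) \<noteq> 0" by simp
  moreover have "continuous_on UNIV (\<lambda>z. (fst z + snd z *\<^sub>R v) \<bullet> (M *v (fst z + snd z *\<^sub>R v)))"
    by (intro continuous_intros linear_continuous_on_compose[OF _ matrix_vector_mul_linear])
  then have *: "(\<lambda>z. (fst z + snd z *\<^sub>R v) \<bullet> (M *v (fst z + snd z *\<^sub>R v)))
      \<in> borel_measurable (lborel \<Otimes>\<^sub>M lborel)"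
    by (simp add: lborel_prod borel_measurable_continuous_onI)
  have "{z \<in> space (lborel \<Otimes>\<^sub>M lborel).
      (fst z + snd z *\<^sub>R v) \<bullet> (M *v (fst z + snd z *\<^sub>R v)) \<noteq> 0} \<in> sets (lborel \<Otimes>\<^sub>M lborel)"
    using measurable_sets[OF *, of "- {0}"] by (simp add: vimage_def Int_def conj_commute)
  ultimately have AE_t: "AE t in (lborel :: real measure). AE x in lborel. (x + t *\<^sub>R v) \<bullet> (M *v (x + t *\<^sub>R v)) \<noteq> 0"
    by (subst (asm) lborel_pair.AE_commute) (simp_all add: case_prod_beta)
  \<comment> \<open>The real line is not a null set, so some \<open>t\<close> qualifies; translation
    invariance of Lebesgue measure then removes the shift by \<open>t\<close> times
    \<open>v\<close>.\<close>
  have "\<not> (AE t in (lborel :: real measure). False)"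
    by (simp add: AE_iff_null null_sets_def)
  then obtain t where t: "AE x in lborel. (x + t *\<^sub>R v) \<bullet> (M *v (x + t *\<^sub>R v)) \<noteq> 0"
    using AE_t by (metis (no_types, lifting) eventually_mono)
  have "open {x. x \<bullet> (M *v x) \<noteq> 0}"
    by (intro open_Collect_neq continuous_intros)
  then have "AE x in distr lborel borel ((+) (t *\<^sub>R v)). x \<bullet> (M *v x) \<noteq> 0"
    using t by (subst AE_distr_iff) (simp_all add: add.commute)
  then have "AE x in lborel. x \<bullet> (M *v x) \<noteq> 0"
    unfolding lborel_distr_plus .
  then show ?thesis by (rule AE_completion)
qed

subsection \<open>The averaged conjugation operator\<close>

text \<open>The dual of one random step: the averaging is moved from the points to the matrix of a
  quadratic form.\<close>

definition avg_conj :: "('k::finite \<Rightarrow> real^'n^'n) \<Rightarrow> real^'n^'n \<Rightarrow> real^'n^'n" where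
  "avg_conj B X = (1 / real CARD('k)) *\<^sub>R (\<Sum>i\<in>UNIV. B i ** X ** B i)"

lemma matrix_mult_scaleR_left: "(c *\<^sub>R X) ** (Y::real^'n^'m) = c *\<^sub>R (X ** Y)"
  by (simp add: vec_eq_iff matrix_matrix_mult_def sum_distrib_left mult.assoc)

lemma matrix_mult_scaleR_right: "(X::real^'m^'k) ** (c *\<^sub>R Y) = c *\<^sub>R (X ** Y)"
  by (simp add: vec_eq_iff matrix_matrix_mult_def sum_distrib_left mult.left_commute)

lemma matrix_mult_add_left: "(X + Y) ** (Z::real^'n^'m) = X ** Z + (Y::real^'m^'k) ** Z"
  by (simp add: vec_eq_iff matrix_matrix_mult_def sum.distrib distrib_right)

lemma linear_avg_conj: "linear (avg_conj B)"
  by (rule linearI)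
    (simp_all add: avg_conj_def matrix_add_ldistrib matrix_mult_add_left sum.distrib scaleR_add_right
      matrix_mult_scaleR_left matrix_mult_scaleR_right scaleR_sum_right scaleR_left_commute)

lemma transpose_avg_conj:
  assumes "\<And>i. transpose (B i) = B i" "transpose X = X"
  shows "transpose (avg_conj B X) = avg_conj B X"
proof -
  have "transpose (B i ** X ** B i) = B i ** X ** B i" for i
    by (simp add: matrix_transpose_mul assms matrix_mul_assoc)
  then show ?thesis
    by (simp add: avg_conj_def transpose_def vec_eq_iff)
qed

lemma avg_conj_self_adjoint:
  assumes "\<And>i. transpose (B i) = B i"
  shows "avg_conj B X \<bullet> Y = X \<bullet> avg_conj B Y"
  by (simp add: avg_conj_def inner_sum_left inner_sum_right inner_matrix_sandwich[OF assms])

text \<open>A symmetric idempotent \<open>B i\<close> can be doubled on both sides of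
  \<open>X\<close>, which makes each term a squared norm. This yields positive semidefiniteness of
  the operator.\<close>

lemma inner_avg_conj_projections:
  fixes B :: "'k::finite \<Rightarrow> real^'n^'n"
  assumes sym: "\<And>i. transpose (B i) = B i" and idem: "\<And>i. B i ** B i = B i"
  shows "X \<bullet> avg_conj B X = (\<Sum>i\<in>UNIV. (norm (B i ** X ** B i))\<^sup>2) / real CARD('k)"
proof -
  have "X \<bullet> (B i ** X ** B i) = (norm (B i ** X ** B i))\<^sup>2" for i
  proof -
    have "(norm (B i ** X ** B i))\<^sup>2 = X \<bullet> (B i ** (B i ** X ** B i) ** B i)"
      by (simp add: power2_norm_eq_inner inner_matrix_sandwich[OF sym])
    also have "B i ** (B i ** X ** B i) ** B i = (B i ** B i) ** X ** (B i ** B i)"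
      by (simp add: matrix_mul_assoc)
    finally show ?thesis by (simp add: idem)
  qed
  then show ?thesis by (simp add: avg_conj_def inner_sum_right)
qed

lemma quadratic_form_avg_conj:
  fixes B :: "'k::finite \<Rightarrow> real^'n^'n"
  assumes "\<And>i. transpose (B i) = B i"
  shows "(\<Sum>i\<in>UNIV. (B i *v y) \<bullet> (X *v (B i *v y))) / real CARD('k) = y \<bullet> (avg_conj B X *v y)"
proof -
  have "(B i *v y) \<bullet> (X *v (B i *v y)) = (B i ** X ** B i) \<bullet> outer y" for i
    by (simp add: inner_outer symmetric_matrix_inner[OF assms] matrix_vector_mul_assoc matrix_mul_assoc)
  then show ?thesis
    by (simp add: avg_conj_def inner_sum_left flip: inner_outer)
qed

subsection \<open>Random coordinate descent\<close>

lemma finite_set_pmf_rcd: "finite (set_pmf (rcd f x0 T))"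
  by (induction T) (auto simp: set_pmf_of_set)

text \<open>All supports are finite, so conditioning on the \<open>T\<close>-th iterate involves
  only finite sums.\<close>

lemma expectation_rcd_Suc:
  fixes x0 :: "real^'n" and h :: "real^'n \<Rightarrow> real"
  shows "measure_pmf.expectation (rcd f x0 (Suc T)) h =
    measure_pmf.expectation (rcd f x0 T)
      (\<lambda>x. (\<Sum>i\<in>UNIV. h (coord_min_step f i x)) / real CARD('n))"
proof -
  have "measure_pmf.expectation (rcd f x0 (Suc T)) h =
      (\<Sum>a\<in>set_pmf (rcd f x0 T). pmf (rcd f x0 T) a *\<^sub>R
        measure_pmf.expectation (map_pmf (\<lambda>i. coord_min_step f i a) (pmf_of_set UNIV)) h)"
    unfolding rcd.simps
    by (rule pmf_expectation_bind) (auto simp: finite_set_pmf_rcd set_pmf_of_set)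
  then show ?thesis
    by (simp del: rcd.simps add: integral_measure_pmf[OF finite_set_pmf_rcd] integral_pmf_of_set
        sum_divide_distrib)
qed

lemma coord_min_step_quadratic_eq:
  fixes A :: "real^'n^'n"
  assumes "transpose A = A" "\<And>i. A $ i $ i = 1"
  shows "coord_min_step (quadratic A) i x = x - (A *v x) $ i *\<^sub>R axis i 1"
proof -
  have "(\<chi> j k. axis i 1 $ j * axis i 1 $ k) = (outer (axis i 1) :: real^'n^'n)"
    by (simp add: outer_def)
  then show ?thesis
    by (simp add: coord_min_step_quadratic[OF assms] matrix_vector_mult_diff_rdistrib
        outer_mult_vec inner_axis' flip: matrix_vector_mul_assoc)
qed

text \<open>In the coordinates \<open>y = C x\<close> with \<open>C\<^sup>2 = A\<close>, an exact coordinate minimization is the orthogonal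
  projection onto the complement of the unit vector \<open>C e\<^sub>i\<close>.\<close>

definition rcd_proj :: "real^'n^'n \<Rightarrow> 'n \<Rightarrow> real^'n^'n" where
  "rcd_proj C i = mat 1 - outer (C *v axis i 1)"

lemma transpose_rcd_proj [simp]:
  fixes C :: "real^'n^'n"
  shows "transpose (rcd_proj C i) = rcd_proj C i"
proof -
  have "transpose (X - Y) = transpose X - transpose Y" for X Y :: "real^'n^'n"
    by (simp add: transpose_def vec_eq_iff)
  then show ?thesis by (simp only: rcd_proj_def transpose_mat transpose_outer)
qed

lemma rcd_proj_mult_vec: "rcd_proj C i *v y = y - ((C *v axis i 1) \<bullet> y) *\<^sub>R (C *v axis i 1)"
  by (simp add: rcd_proj_def matrix_vector_mult_diff_rdistrib outer_mult_vec)

context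
  fixes A C :: "real^'n^'n"
  assumes symA: "transpose A = A" and diag: "\<And>i. A $ i $ i = 1"
    and symC: "transpose C = C" and CC: "C ** C = A"
begin

lemma inner_sqrt_axis: "(C *v axis i 1) \<bullet> (C *v x) = (A *v x) $ i"
  by (simp add: symmetric_matrix_inner[OF symC] matrix_vector_mul_assoc CC inner_axis')

lemma inner_sqrt_axis_self: "(C *v axis i 1) \<bullet> (C *v axis i 1) = 1"
  using diag[of i] by (simp add: inner_sqrt_axis matrix_vector_mul_component inner_axis)

lemma rcd_proj_idem: "rcd_proj C i ** rcd_proj C i = rcd_proj C i"
  by (simp add: matrix_eq rcd_proj_mult_vec inner_diff_right inner_sqrt_axis_self
      flip: matrix_vector_mul_assoc)

lemma sqrt_mult_coord_min_step:
  "C *v coord_min_step (quadratic A) i x = rcd_proj C i *v (C *v x)"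
  by (simp add: coord_min_step_quadratic_eq[OF symA diag] rcd_proj_mult_vec inner_sqrt_axis
      matrix_vector_mult_diff_distrib matrix_vector_mult_scaleR)

text \<open>Averaging over the last index replaces \<open>X\<close> by its image under
  \<open>avg_conj\<close>; the induction hypothesis is then applied to that image, hence the general
  \<open>X\<close>.\<close>

lemma expectation_rcd_quadratic_form:
  "measure_pmf.expectation (rcd (quadratic A) x0 T) (\<lambda>x. (C *v x) \<bullet> (X *v (C *v x)))
    = (C *v x0) \<bullet> ((avg_conj (rcd_proj C) ^^ T) X *v (C *v x0))"
proof (induction T arbitrary: X)
  case 0
  then show ?case by simp
next
  case (Suc T)
  show ?case
    unfolding expectation_rcd_Suc sqrt_mult_coord_min_step
    by (simp add: quadratic_form_avg_conj Suc funpow_swap1)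
qed

text \<open>By idempotence each term is the trace of \<open>rcd_proj C i\<close>: the dimension less
  1 for the unit vector projected out.\<close>

lemma inner_mat_1_avg_conj:
  "mat 1 \<bullet> avg_conj (rcd_proj C) (mat 1) = real CARD('n) - 1"
proof -
  have "mat 1 \<bullet> rcd_proj C i = real CARD('n) - 1" for i
    by (simp add: inner_matrix_trace transpose_mat rcd_proj_def trace_sub trace_I trace_outer
        inner_sqrt_axis_self)
  then show ?thesis
    by (simp add: avg_conj_def inner_sum_right rcd_proj_idem)
qed

text \<open>The right-hand side is the mean of the squares of the numbers \<open>a i\<close>, hence
  at least the square of their mean.\<close>

lemma inner_outer_avg_conj_ge:
  assumes "norm v = 1" "A *v v = s *\<^sub>R v"
  shows "(1 - s / real CARD('n))\<^sup>2 \<le> outer v \<bullet> avg_conj (rcd_proj C) (outer v)"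
proof -
  define n where "n = real CARD('n)"
  have n: "n > 0" by (simp add: n_def)
  define a where "a i = v \<bullet> (rcd_proj C i *v v)" for i
  have vv: "v \<bullet> v = 1" using assms by (simp add: dot_square_norm)
  have a: "a i = 1 - ((C *v v) $ i)\<^sup>2" for i
  proof -
    have "(C *v axis i 1) \<bullet> v = (C *v v) $ i"
      by (simp add: symmetric_matrix_inner[OF symC] inner_axis')
    then show ?thesis
      by (simp add: a_def rcd_proj_mult_vec inner_diff_right vv power2_eq_square
          inner_commute[of v "C *v axis i 1"])
  qed
  have "(\<Sum>i\<in>UNIV. ((C *v v) $ i)\<^sup>2) = (C *v v) \<bullet> (C *v v)"
    by (simp add: inner_vec_def power2_eq_square)
  \<comment> \<open>\<open>C\<close> squares to \<open>A\<close>, so this is the form of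
    \<open>A\<close> at \<open>v\<close>; it fixes the mean of the \<open>a i\<close> as
    \<open>1 - s / n\<close>.\<close>
  also have "\<dots> = s"
    by (simp add: symmetric_matrix_inner[OF symC] matrix_vector_mul_assoc CC assms vv)
  finally have "(\<Sum>i\<in>UNIV. a i) = n - s"
    by (simp add: a sum_subtractf n_def)
  moreover have "(\<Sum>i\<in>UNIV. a i)\<^sup>2 \<le> n * (\<Sum>i\<in>UNIV. (a i)\<^sup>2)"
    using sum_squared_le_sum_of_squares[of a UNIV] by (simp add: n_def mult.commute)
  moreover have "outer v \<bullet> avg_conj (rcd_proj C) (outer v) = (\<Sum>i\<in>UNIV. (a i)\<^sup>2) / n"
  proof -
    have "v \<bullet> ((rcd_proj C i ** outer v ** rcd_proj C i) *v v) = (a i)\<^sup>2" for i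
      by (simp add: outer_mult_vec matrix_vector_mult_scaleR a_def power2_eq_square
          flip: matrix_vector_mul_assoc)
    then show ?thesis
      unfolding inner_commute[of "outer v"] avg_conj_def inner_scaleR_left inner_sum_left
      by (simp add: n_def inner_outer)
  qed
  moreover have "1 - s / n = (n - s) / n"
    using n by (simp add: diff_divide_distrib)
  ultimately have "(1 - s / n)\<^sup>2 \<le> n * (outer v \<bullet> avg_conj (rcd_proj C) (outer v)) * n / n\<^sup>2"
    using n by (simp add: power_divide divide_right_mono mult.commute)
  then show ?thesis using n by (simp add: power2_eq_square flip: n_def)
qed

end

section \<open>Growth rate of the expected squared norm\<close>

lemma powr_inverse_limit:
  fixes e :: "nat \<Rightarrow> real"
  assumes "0 < a" "0 < b" "0 \<le> r" "\<And>T. a * r ^ T \<le> e T" "\<And>T. e T \<le> b * r ^ T"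
  shows "(\<lambda>T. e T powr (1 / real T)) \<longlonglongrightarrow> r"
proof -
  \<comment> \<open>Constant factors disappear under \<open>T\<close>-th roots, so both bounds have
    the limit \<open>r\<close>.\<close>
  have lim: "(\<lambda>T. (c * r ^ T) powr (1 / real T)) \<longlonglongrightarrow> r" if "c > 0" for c
  proof -
    have "(\<lambda>T. c powr (1 / real T) * r) \<longlonglongrightarrow> c powr 0 * r"
      using that by (intro tendsto_intros lim_1_over_n) auto
    moreover have "\<forall>\<^sub>F T in sequentially. (c * r ^ T) powr (1 / real T) = c powr (1 / real T) * r"
      \<comment> \<open>At \<open>T = 0\<close> the exponent \<open>1 / real T\<close> is 0 by
        convention, so that index is left out.\<close>
      using eventually_gt_at_top[of 0]
    proof eventually_elim
      case (elim T)
      \<comment> \<open>The case \<open>r = 0\<close> does occur: in dimension one the first step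
        reaches the origin.\<close>
      then have "(r ^ T) powr (1 / real T) = r"
        using assms(3) by (cases "r = 0") (simp_all add: powr_powr flip: powr_realpow)
      then show ?case using that assms(3) by (simp add: powr_mult)
    qed
    ultimately show ?thesis using that by (simp add: tendsto_cong)
  qed
  have "0 \<le> e T" for T
    using assms(1,3) assms(4)[of T] by (meson mult_nonneg_nonneg less_imp_le order_trans zero_le_power)
  then show ?thesis
    using assms
    by (intro tendsto_sandwich[OF _ _ lim[of a] lim[of b]] always_eventually allI powr_mono2) auto
qed

theorem theorem3p1:
  fixes A :: "real^'n^'n" and \<sigma> :: real
  assumes "transpose A = A"
    and "positive_definite A"
    and "\<forall>i. A $ i $ i = 1"
    and "\<sigma> = lambda_min A"
  shows "AE x0 in lebesgue.
    \<exists>l. (\<lambda>T. (measure_pmf.expectation (rcd (quadratic A) x0 T) (\<lambda>x. (norm x)\<^sup>2) / (norm x0)\<^sup>2)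
              powr (1 / real T)) \<longlonglongrightarrow> l
      \<and> l \<ge> max (1 - 1 / real CARD('n)) ((1 - \<sigma> / real CARD('n))\<^sup>2)"
proof -
  note symA = assms(1) and diag = assms(3)[rule_format]
  define n where "n = real CARD('n)"
  have n: "n > 0" by (simp add: n_def)
  obtain C where symC: "transpose C = C" and CC: "C ** C = A" and inv: "invertible C"
    using positive_definite_sqrt[OF assms(1,2)] by blast
  define K where "K = avg_conj (rcd_proj C)"
  define S where "S = {X :: real^'n^'n. transpose X = X}"
  have linK: "linear K" unfolding K_def by (rule linear_avg_conj)
  have S: "subspace S"
    by (auto simp: subspace_def S_def transpose_def vec_eq_iff)
  have KS: "K X \<in> S" if "X \<in> S" for X
    using that by (simp add: K_def S_def transpose_avg_conj)
  have saK: "K X \<bullet> Y = X \<bullet> K Y" for X Y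
    unfolding K_def by (rule avg_conj_self_adjoint) simp
  have psd: "0 \<le> X \<bullet> K X" for X
    unfolding K_def
    by (subst inner_avg_conj_projections)
      (auto simp: rcd_proj_idem[OF symA diag symC CC] intro!: divide_nonneg_nonneg sum_nonneg)
  have I: "mat 1 \<in> S" "mat 1 \<bullet> (mat 1 :: real^'n^'n) = n"
    by (simp_all add: S_def transpose_mat inner_matrix_trace trace_I n_def)
  then have "mat 1 \<noteq> (0 :: real^'n^'n)" using n by auto
  then obtain M r where M: "M \<in> S" "norm M = 1" "K M = r *\<^sub>R M"
    and r: "\<And>X. X \<in> S \<Longrightarrow> X \<bullet> K X \<le> r * (X \<bullet> X)"
    using self_adjoint_max_eigenvector[OF linK S KS saK I(1)] by metis
  have r0: "0 \<le> r"
    using psd[of M] M by (simp add: dot_square_norm)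
  have r1: "1 - 1 / n \<le> r"
    using r[OF I(1)] I(2) n inner_mat_1_avg_conj[OF symA diag symC CC]
    by (simp add: K_def n_def field_simps)
  have r2: "(1 - \<sigma> / n)\<^sup>2 \<le> r"
  proof -
    obtain v where v: "norm v = 1" "A *v v = \<sigma> *\<^sub>R v"
      using lambda_min_eigenvector[OF symA] assms(4) by metis
    have "v \<bullet> v = 1" using v by (simp add: dot_square_norm)
    then have "outer v \<bullet> outer v = 1" by (simp add: inner_outer outer_mult_vec)
    moreover have "outer v \<in> S" by (simp add: S_def)
    ultimately show ?thesis
      using inner_outer_avg_conj_ge[OF symA diag symC CC v] r[of "outer v"] by (simp add: K_def n_def)
  qed

  have KM: "(K ^^ T) M = r ^ T *\<^sub>R M" for T
    by (induction T) (simp_all add: linear_scale[OF linK] M)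
  \<comment> \<open>The norm bound by \<open>r\<close> is available only on \<open>S\<close>, so
    membership is carried through the induction.\<close>
  have KI: "(K ^^ T) (mat 1) \<in> S \<and> norm ((K ^^ T) (mat 1)) \<le> r ^ T * norm (mat 1 :: real^'n^'n)" for T
  proof (induction T)
    case 0
    then show ?case using I by simp
  next
    case (Suc T)
    have "norm (K ((K ^^ T) (mat 1))) \<le> r * norm ((K ^^ T) (mat 1))"
      using Suc by (intro self_adjoint_psd_norm_le[OF linK S KS saK psd r r0]) auto
    also have "\<dots> \<le> r * (r ^ T * norm (mat 1 :: real^'n^'n))"
      using Suc r0 by (intro mult_left_mono) auto
    finally show ?case using Suc KS by (simp add: mult.assoc)
  qed

  obtain D where "C ** D = mat 1" "D ** C = mat 1"
    using inv unfolding invertible_def by blast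
  then have DC: "D *v (C *v x) = x" and CD: "C *v (D *v x) = x" for x
    by (simp_all add: matrix_vector_mul_assoc)
  \<comment> \<open>The zero set of \<open>q\<close> is the exceptional set of initial
    points.\<close>
  define q where "q x = (C *v x) \<bullet> (M *v (C *v x))" for x
  obtain cD where cD: "cD > 0" "\<And>x. norm (D *v x) \<le> norm x * cD"
    using bounded_linear.pos_bounded[OF matrix_vector_mul_bounded_linear] by blast
  obtain cC where cC: "cC > 0" "\<And>x. norm (C *v x) \<le> norm x * cC"
    using bounded_linear.pos_bounded[OF matrix_vector_mul_bounded_linear] by blast
  obtain cM where cM: "cM > 0" "\<And>x. norm (M *v x) \<le> norm x * cM"
    using bounded_linear.pos_bounded[OF matrix_vector_mul_bounded_linear] by blast
  note Eq = expectation_rcd_quadratic_form[OF symA diag symC CC, folded K_def]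
  have int: "integrable (measure_pmf (rcd (quadratic A) x0 T)) h" for x0 T and h :: "real^'n \<Rightarrow> real"
    by (intro integrable_measure_pmf_finite finite_set_pmf_rcd)

  have conclusion: "\<exists>l. (\<lambda>T. (measure_pmf.expectation (rcd (quadratic A) x0 T) (\<lambda>x. (norm x)\<^sup>2) / (norm x0)\<^sup>2)
              powr (1 / real T)) \<longlonglongrightarrow> l
      \<and> l \<ge> max (1 - 1 / real CARD('n)) ((1 - \<sigma> / real CARD('n))\<^sup>2)"
    if q0: "q x0 \<noteq> 0" for x0
  proof (intro exI conjI)
    define e where "e T = measure_pmf.expectation (rcd (quadratic A) x0 T) (\<lambda>x. (norm x)\<^sup>2)" for T
    define y where "y = C *v x0"
    \<comment> \<open>The origin is a zero of \<open>q\<close>, so the denominator of the ratio is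
      nonzero.\<close>
    have x0: "x0 \<noteq> 0" using q0 by (auto simp: q_def)
    \<comment> \<open>Needed for a strictly positive constant in the upper bound.\<close>
    have y0: "outer y \<noteq> 0"
    proof
      assume "outer y = 0"
      then show False using q0 by (simp add: q_def flip: y_def inner_outer)
    qed
    have upper: "e T \<le> cD\<^sup>2 * norm (mat 1 :: real^'n^'n) * norm (outer y) * r ^ T" for T
    proof -
      \<comment> \<open>\<open>D\<close> inverts \<open>C\<close>, so \<open>x\<close> is controlled
        by \<open>C *v x\<close>, whose expected squared norm is the case
        \<open>X = mat 1\<close>.\<close>
      have "(norm x)\<^sup>2 \<le> cD\<^sup>2 * ((C *v x) \<bullet> (mat 1 *v (C *v x)))" for x
      proof -
        have "norm x \<le> norm (C *v x) * cD" using cD(2)[of "C *v x"] by (simp add: DC)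
        then have "(norm x)\<^sup>2 \<le> (norm (C *v x) * cD)\<^sup>2" by (intro power_mono) auto
        then show ?thesis by (simp add: power_mult_distrib power2_norm_eq_inner mult.commute)
      qed
      then have "e T \<le> measure_pmf.expectation (rcd (quadratic A) x0 T)
          (\<lambda>x. cD\<^sup>2 * ((C *v x) \<bullet> (mat 1 *v (C *v x))))"
        unfolding e_def by (intro integral_mono int)
      also have "\<dots> = cD\<^sup>2 * ((K ^^ T) (mat 1) \<bullet> outer y)"
        by (simp only: integral_mult_right_zero Eq inner_outer y_def)
      also have "(K ^^ T) (mat 1) \<bullet> outer y \<le> norm ((K ^^ T) (mat 1)) * norm (outer y)"
        by (rule norm_cauchy_schwarz)
      also have "\<dots> \<le> r ^ T * norm (mat 1 :: real^'n^'n) * norm (outer y)"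
        using KI by (intro mult_right_mono) auto
      finally show ?thesis using cD(1) by (simp add: mult_ac)
    qed
    have lower: "\<bar>q x0\<bar> / (cC\<^sup>2 * cM) * r ^ T \<le> e T" for T
    proof -
      have bound: "\<bar>q x\<bar> \<le> cC\<^sup>2 * cM * (norm x)\<^sup>2" for x
      proof -
        have "\<bar>q x\<bar> \<le> norm (C *v x) * norm (M *v (C *v x))"
          unfolding q_def by (rule Cauchy_Schwarz_ineq2)
        also have "\<dots> \<le> norm (C *v x) * (norm (C *v x) * cM)"
          using cM by (intro mult_left_mono) auto
        also have "\<dots> \<le> (norm x * cC) * ((norm x * cC) * cM)"
          using cC cM by (intro mult_mono) auto
        finally show ?thesis by (simp add: power2_eq_square mult_ac)
      qed
      \<comment> \<open>Since \<open>M\<close> is an eigenmatrix, the expectation of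
        \<open>q\<close> is exactly \<open>r ^ T * q x0\<close>.\<close>
      have "r ^ T * \<bar>q x0\<bar> = \<bar>measure_pmf.expectation (rcd (quadratic A) x0 T) q\<bar>"
        unfolding q_def[abs_def] Eq KM using r0
        by (simp add: abs_mult flip: scaleR_matrix_vector_assoc)
      also have "\<dots> \<le> measure_pmf.expectation (rcd (quadratic A) x0 T) (\<lambda>x. \<bar>q x\<bar>)"
        by (rule integral_abs_bound)
      also have "\<dots> \<le> measure_pmf.expectation (rcd (quadratic A) x0 T) (\<lambda>x. cC\<^sup>2 * cM * (norm x)\<^sup>2)"
        using bound by (intro integral_mono int)
      also have "\<dots> = cC\<^sup>2 * cM * e T"
        by (simp add: e_def)
      finally show ?thesis using cC cM by (simp add: field_simps)
    qed
    show "(\<lambda>T. (e T / (norm x0)\<^sup>2) powr (1 / real T)) \<longlonglongrightarrow> r"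
    proof (rule powr_inverse_limit[OF _ _ r0])
      show "0 < \<bar>q x0\<bar> / (cC\<^sup>2 * cM) / (norm x0)\<^sup>2" using q0 x0 cC cM by simp
      show "0 < cD\<^sup>2 * norm (mat 1 :: real^'n^'n) * norm (outer y) / (norm x0)\<^sup>2"
        using y0 x0 cD \<open>mat 1 \<noteq> 0\<close> by simp
      show "\<bar>q x0\<bar> / (cC\<^sup>2 * cM) / (norm x0)\<^sup>2 * r ^ T \<le> e T / (norm x0)\<^sup>2" for T
        using divide_right_mono[OF lower, of "(norm x0)\<^sup>2" T] by simp
      show "e T / (norm x0)\<^sup>2 \<le> cD\<^sup>2 * norm (mat 1 :: real^'n^'n) * norm (outer y) / (norm x0)\<^sup>2 * r ^ T" for T
        using divide_right_mono[OF upper, of "(norm x0)\<^sup>2" T] by simp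
    qed
    show "max (1 - 1 / real CARD('n)) ((1 - \<sigma> / real CARD('n))\<^sup>2) \<le> r"
      using r1 r2 by (simp add: n_def)
  qed

  have q: "q x = x \<bullet> ((C ** M ** C) *v x)" for x
    by (simp add: q_def symmetric_matrix_inner[OF symC] flip: matrix_vector_mul_assoc)
  have "transpose M = M" "M \<noteq> 0" using M by (auto simp: S_def)
  then obtain w where "w \<bullet> (M *v w) \<noteq> 0"
    by (rule symmetric_quadratic_form_nonzero)
  \<comment> \<open>Pulling \<open>w\<close> back through \<open>C\<close> gives a point where the
    form of \<open>C ** M ** C\<close> does not vanish.\<close>
  then have "q (D *v w) \<noteq> 0" by (simp add: q_def CD)
  then have "AE x0 in lebesgue. q x0 \<noteq> 0"
    unfolding q[abs_def] by (rule AE_quadratic_form_nonzero)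
  then show ?thesis by eventually_elim (rule conclusion)
qed

end
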